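(* Let $m\ge 2$, and let $a_1,\ldots,a_s,b_1,\ldots,b_t$ be distinct elements of $\{1,\ldots,m\}$ with $s\ge 0$, $t\ge 1$, $m\ge s+t\ge 2$. If the polytope $[[a_1,a_2,\ldots,a_s],[b_1,b_2,\ldots,b_t]]_m$ is not simplicial (i.e. is not a simplex), then it is the union of two convex polytopes as follows: $$[[a_1,a_2,\ldots,a_s],[b_1,b_2,\ldots,b_t]]_m=\mathrm{conv}\{M_{a_1,b_1},[[a_2,\ldots,a_s],[b_1,b_2,\ldots,b_t]]_m\}\ \cup\ \mathrm{conv}\{M_{a_1,b_1},[[a_1,a_2,\ldots,a_s],[b_2,\ldots,b_t]]_m\}.$$
   Context: The standard simplex is $\Delta_m=\{(y_1,\ldots,y_m)^T\in\mathbb{R}^m : y_1+\cdots+y_m=1,\ y_1\ge 0,\ldots,y_m\ge 0\}$, with vertices $e_1,\ldots,e_m$ (the standard basis vectors). $M_{i,j}=(e_i+e_j)/2$ is the midpoint of the segment $\overline{e_ie_j}$. For distinct $a_1,\ldots,a_s,b_1,\ldots,b_t\in\{1,\ldots,m\}$ with $s\ge 0$, $t\ge 1$, $m\ge s+t\ge 2$, the notation $[[a_1,\ldots,a_s],[b_1,\ldots,b_t]]_m$ denotes the polytope $$\{(y_1,\ldots,y_m)^T\in\Delta_m : y_{a_1}+\cdots+y_{a_s}-y_{b_1}-\cdots-y_{b_t}\le 0,\ (y_{a_1},\ldots,y_{a_s},y_{b_1},\ldots,y_{b_t})^T\in\Delta_{s+t}\}.$$ In particular every coordinate $y_i$ with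 $i\notin\{a_1,\ldots,a_s,b_1,\ldots,b_t\}$ is $0$ on it. The first list may be empty ($s=0$). $\mathrm{conv}\{p,S\}$, for a point $p$ and a set $S$, denotes the convex hull of $\{p\}\cup S$. *)

theory Defs
  imports "HOL-Analysis.Analysis"
begin

text \<open>The ambient space is \<open>real ^ 'n\<close>, so \<open>m = CARD('n)\<close> and the index set
  \<open>{1, ..., m}\<close> is the type \<open>'n\<close>.\<close>

definition std_simplex :: "(real ^ 'n) set" where
  "std_simplex = {y. (\<Sum>i\<in>UNIV. y $ i) = 1 \<and> (\<forall>i. 0 \<le> y $ i)}"

text \<open>The standard simplex in \<open>k\<close> coordinates, \<open>k\<close> a term: its points are written as
  tuples (lists of length \<open>k\<close>), because \<open>s + t\<close> depends on the given index lists.\<close>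

definition std_simplex_tuples :: "nat \<Rightarrow> real list set" where
  "std_simplex_tuples k =
     {xs. length xs = k \<and> sum_list xs = 1 \<and> (\<forall>x\<in>set xs. 0 \<le> x)}"

text \<open>\<open>[[a\<^sub>1, ..., a\<^sub>s], [b\<^sub>1, ..., b\<^sub>t]]\<^sub>m\<close>\<close>

definition bracket :: "'n list \<Rightarrow> 'n list \<Rightarrow> (real ^ 'n) set" where
  "bracket a b =
     {y \<in> std_simplex.
        (\<Sum>i\<leftarrow>a. y $ i) - (\<Sum>j\<leftarrow>b. y $ j) \<le> 0 \<and>
        map (\<lambda>i. y $ i) (a @ b) \<in> std_simplex_tuples (length a + length b)}"

definition edge_midpoint :: "'n \<Rightarrow> 'n \<Rightarrow> real ^ 'n" where
  "edge_midpoint i j = midpoint (axis i 1) (axis j 1)"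

definition is_simplex :: "'a::euclidean_space set \<Rightarrow> bool" where
  "is_simplex S \<longleftrightarrow> (\<exists>n. n simplex S)"

end

theory Submission
  imports Defs
begin

text \<open>Given \<open>y\<close> in the polytope, put \<open>c = min (y\<^sub>a, y\<^sub>b)\<close> for \<open>a = a\<^sub>1\<close>, \<open>b = b\<^sub>1\<close>. Subtracting
  \<open>2c M\<^sub>a\<^sub>b\<close> from \<open>y\<close> and rescaling leaves a point of the polytope with \<open>a\<close>-coordinate or
  \<open>b\<close>-coordinate zero, i.e. a point of one of the two smaller polytopes. Iterating this step
  shows that the polytope is the convex hull of the midpoints \<open>M\<^sub>i\<^sub>j\<close> with \<open>j\<close> in the second
  list and \<open>i\<close> in either list. If the first list is empty, the polytope is a face of the
  standard simplex, hence itself a simplex; so \<open>a\<^sub>1\<close> exists.\<close>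

lemma edge_midpoint_nth:
  "edge_midpoint a b $ i = (if i = a then 1/2 else 0) + (if i = b then 1/2 else 0)"
  by (simp add: edge_midpoint_def midpoint_def axis_def)

lemma edge_midpoint_self [simp]: "edge_midpoint a a = axis a 1"
  by (simp add: edge_midpoint_def)

text \<open>The working description of the polytope. All coordinates and the listed ones alone both
  sum to 1, so the nonnegative unlisted ones sum to 0 and vanish. Distinctness turns sums over lists
  into sums over sets.\<close>

lemma mem_bracket_iff:
  fixes a b :: "'n::finite list"
  assumes "distinct (a @ b)"
  shows "y \<in> bracket a b \<longleftrightarrow>
    (\<forall>i. 0 \<le> y $ i) \<and> (\<forall>i. i \<notin> set a \<union> set b \<longrightarrow> y $ i = 0) \<and>
    (\<Sum>i\<in>set a. y $ i) + (\<Sum>i\<in>set b. y $ i) = 1 \<and>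
    (\<Sum>i\<in>set a. y $ i) \<le> (\<Sum>i\<in>set b. y $ i)"
proof -
  have d: "distinct a" "distinct b" "set a \<inter> set b = {}" using assms by auto
  have ab: "(\<Sum>i\<in>set a \<union> set b. y $ i) = (\<Sum>i\<in>set a. y $ i) + (\<Sum>i\<in>set b. y $ i)"
    by (simp add: sum.union_disjoint d)
  have split: "(\<Sum>i\<in>UNIV. y $ i) = (\<Sum>i\<in>set a \<union> set b. y $ i) + (\<Sum>i\<in>- (set a \<union> set b). y $ i)"
    by (metis Compl_eq_Diff_UNIV finite add.commute subset_UNIV sum.subset_diff)
  have zero: "(\<Sum>i\<in>- (set a \<union> set b). y $ i) = 0 \<longleftrightarrow> (\<forall>i. i \<notin> set a \<union> set b \<longrightarrow> y $ i = 0)"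
    if "\<forall>i. 0 \<le> y $ i"
    using that by (subst sum_nonneg_eq_0_iff) auto
  show ?thesis
    unfolding bracket_def std_simplex_def std_simplex_tuples_def
    using zero split ab d by (auto simp: sum_list_distinct_conv_sum_set)
qed

text \<open>Dropping an index cuts out a face. This yields the inclusion of the smaller polytopes,
  and it places a point with a vanishing coordinate in one of them.\<close>

lemma bracket_Cons_left: "bracket as bs = {y \<in> bracket (a # as) bs. y $ a = 0}"
  if "a \<notin> set as \<union> set bs" "distinct (as @ bs)"
  using that by (auto simp: mem_bracket_iff)

lemma bracket_Cons_right: "bracket as bs = {y \<in> bracket as (b # bs). y $ b = 0}"
  if "b \<notin> set as \<union> set bs" "distinct (as @ bs)"
  using that by (auto simp: mem_bracket_iff)

lemma convex_bracket:
  fixes a b :: "'n::finite list"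
  assumes "distinct (a @ b)"
  shows "convex (bracket a b)"
proof (rule convexI)
  fix x y :: "real ^ 'n" and u v :: real
  assume x: "x \<in> bracket a b" and y: "y \<in> bracket a b" and uv: "0 \<le> u" "0 \<le> v" "u + v = 1"
  have S: "(\<Sum>i\<in>I. (u *\<^sub>R x + v *\<^sub>R y) $ i) = u * (\<Sum>i\<in>I. x $ i) + v * (\<Sum>i\<in>I. y $ i)" for I
    by (simp add: sum.distrib sum_distrib_left)
  have "u * (\<Sum>i\<in>set a. x $ i) \<le> u * (\<Sum>i\<in>set b. x $ i)"
    and "v * (\<Sum>i\<in>set a. y $ i) \<le> v * (\<Sum>i\<in>set b. y $ i)"
    using x y uv by (auto simp: mem_bracket_iff[OF assms] intro: mult_left_mono)
  moreover have "u * ((\<Sum>i\<in>set a. x $ i) + (\<Sum>i\<in>set b. x $ i))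
      + v * ((\<Sum>i\<in>set a. y $ i) + (\<Sum>i\<in>set b. y $ i)) = 1"
    using x y uv by (simp add: mem_bracket_iff[OF assms])
  then have "u * (\<Sum>i\<in>set a. x $ i) + v * (\<Sum>i\<in>set a. y $ i)
      + (u * (\<Sum>i\<in>set b. x $ i) + v * (\<Sum>i\<in>set b. y $ i)) = 1"
    by (simp only: distrib_left add_ac)
  ultimately show "u *\<^sub>R x + v *\<^sub>R y \<in> bracket a b"
    using x y uv unfolding mem_bracket_iff[OF assms] S by simp
qed

lemma sum_edge_midpoint:
  "finite I \<Longrightarrow> (\<Sum>i\<in>I. edge_midpoint a b $ i) = (if a \<in> I then 1/2 else 0) + (if b \<in> I then 1/2 else 0)"
  by (simp add: edge_midpoint_nth sum.distrib)

lemma edge_midpoint_in_bracket: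
  fixes as bs :: "'n::finite list"
  assumes "distinct (as @ bs)" "i \<in> set as \<union> set bs" "j \<in> set bs"
  shows "edge_midpoint i j \<in> bracket as bs"
proof -
  have "\<forall>k. 0 \<le> edge_midpoint i j $ k"
    "\<forall>k. k \<notin> set as \<union> set bs \<longrightarrow> edge_midpoint i j $ k = 0"
    using assms by (auto simp: edge_midpoint_nth)
  then show ?thesis
    using assms by (auto simp: mem_bracket_iff sum_edge_midpoint)
qed

text \<open>Removing the amount \<open>c\<close> from one index of each list lowers both partial
  sums equally, so the inequality between them survives; rescaling restores total sum 1.\<close>

lemma bracket_peel:
  fixes as bs :: "'n::finite list"
  assumes d: "distinct (as @ bs)" and a: "a \<in> set as" and b: "b \<in> set bs"
    and y: "y \<in> bracket as bs" and c: "0 \<le> c" "c \<le> y $ a" "c \<le> y $ b"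
  obtains "y = edge_midpoint a b"
  | z where "z \<in> bracket as bs" "y \<in> convex hull {edge_midpoint a b, z}"
      "c = y $ a \<Longrightarrow> z $ a = 0" "c = y $ b \<Longrightarrow> z $ b = 0"
proof -
  define A where "A = (\<Sum>i\<in>set as. y $ i)"
  define B where "B = (\<Sum>i\<in>set bs. y $ i)"
  have y': "\<And>i. 0 \<le> y $ i" "\<And>i. i \<notin> set as \<union> set bs \<Longrightarrow> y $ i = 0" "A + B = 1" "A \<le> B"
    using y by (simp_all add: mem_bracket_iff[OF d] A_def B_def)
  have ab: "a \<noteq> b" "a \<notin> set bs" "b \<notin> set as" using d a b by auto
  have "y $ a \<le> A" unfolding A_def using a y'(1) by (intro member_le_sum) auto
  \<comment> \<open>\<open>c \<le> A \<le> B\<close> and \<open>A + B = 1\<close>.\<close>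
  then have c_le: "c \<le> 1/2" using c y' by linarith
  define w where "w = y - (2 * c) *\<^sub>R edge_midpoint a b"
  have w_nth: "w $ i = (if i = a \<or> i = b then y $ i - c else y $ i)" for i
    using ab by (simp add: w_def edge_midpoint_nth)
  have w_nonneg: "0 \<le> w $ i" for i using y'(1) c by (simp add: w_nth)
  have w_out: "w $ i = 0" if "i \<notin> set as \<union> set bs" for i
    using y'(2) that a b by (auto simp: w_nth)
  have w_sum: "(\<Sum>i\<in>I. w $ i) = (\<Sum>i\<in>I. y $ i) - 2 * c * (\<Sum>i\<in>I. edge_midpoint a b $ i)" for I
    by (simp add: w_def sum_subtractf sum_distrib_left)
  have wA: "(\<Sum>i\<in>set as. w $ i) = A - c" and wB: "(\<Sum>i\<in>set bs. w $ i) = B - c"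
    using a b ab by (simp_all add: w_sum sum_edge_midpoint A_def B_def)
  show ?thesis
  proof (cases "c = 1/2")
    case True
    \<comment> \<open>All the mass is removed: \<open>w\<close> is nonnegative with both partial
      sums 0, so no remainder is left to rescale.\<close>
    have "A = c" "B = c"
      using True y'(3,4) \<open>y $ a \<le> A\<close> c by linarith+
    then have "w $ i = 0" for i
      using w_out[of i] wA wB w_nonneg
      by (cases "i \<in> set as \<union> set bs") (auto simp: sum_nonneg_eq_0_iff)
    then have "w = 0" by (simp add: vec_eq_iff)
    then show ?thesis using True that(1) by (simp add: w_def)
  next
    case False
    \<comment> \<open>\<open>k\<close> is the total mass \<open>(A - c) + (B - c)\<close> of
      \<open>w\<close>; as \<open>y\<close> is \<open>w\<close> plus \<open>2 * c\<close> times the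
      midpoint, \<open>k\<close> and \<open>1 - k\<close> are the convex weights.\<close>
    define k where "k = 1 - 2 * c"
    have k: "0 < k" using False c_le by (simp add: k_def)
    have S: "(\<Sum>i\<in>I. (inverse k *\<^sub>R w) $ i) = (\<Sum>i\<in>I. w $ i) / k" for I
      by (simp add: sum_distrib_left divide_inverse mult.commute)
    have z: "inverse k *\<^sub>R w \<in> bracket as bs"
      unfolding mem_bracket_iff[OF d] S wA wB
      using w_nonneg w_out k y'(3,4)
      by (simp add: divide_right_mono add_divide_distrib[symmetric]) (simp add: k_def)
    have y_eq: "y = (1 - k) *\<^sub>R edge_midpoint a b + k *\<^sub>R (inverse k *\<^sub>R w)"
      using k by (simp add: w_def k_def)
    have "y \<in> convex hull {edge_midpoint a b, inverse k *\<^sub>R w}"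
      unfolding y_eq using k c by (intro convexD[OF convex_convex_hull]) (auto simp: hull_inc k_def)
    then show ?thesis by (rule that(2)[OF z]) (simp_all add: w_nth)
  qed
qed

lemma bracket_subset_Un:
  fixes as bs :: "'n::finite list"
  assumes d: "distinct ((a # as) @ (b # bs))"
  shows "bracket (a # as) (b # bs) \<subseteq>
    convex hull (insert (edge_midpoint a b) (bracket as (b # bs))) \<union>
    convex hull (insert (edge_midpoint a b) (bracket (a # as) bs))"
proof
  fix y assume y: "y \<in> bracket (a # as) (b # bs)"
  \<comment> \<open>The minimum is the largest amount that can be removed without a coordinate
    becoming negative, and removing it makes one of the two coordinates zero.\<close>
  have le: "0 \<le> min (y $ a) (y $ b)" using y by (simp add: mem_bracket_iff[OF d])
  have c_cases: "min (y $ a) (y $ b) = y $ a \<or> min (y $ a) (y $ b) = y $ b"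
    by (simp add: min_def)
  consider "y = edge_midpoint a b"
    | z where "z \<in> bracket (a # as) (b # bs)" "y \<in> convex hull {edge_midpoint a b, z}"
        "z $ a = 0 \<or> z $ b = 0"
  proof (rule bracket_peel[OF d _ _ y le, of a b])
    fix z assume "z \<in> bracket (a # as) (b # bs)" "y \<in> convex hull {edge_midpoint a b, z}"
      "min (y $ a) (y $ b) = y $ a \<Longrightarrow> z $ a = 0" "min (y $ a) (y $ b) = y $ b \<Longrightarrow> z $ b = 0"
    with c_cases show thesis by (blast intro: that(2))
  qed (auto intro: that(1))
  then show "y \<in> convex hull (insert (edge_midpoint a b) (bracket as (b # bs))) \<union>
    convex hull (insert (edge_midpoint a b) (bracket (a # as) bs))"
  proof cases
    case 1
    then show ?thesis by (simp add: hull_inc)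
  next
    case 2
    then have "z \<in> bracket as (b # bs) \<or> z \<in> bracket (a # as) bs"
      using d bracket_Cons_left[of a as "b # bs"] bracket_Cons_right[of b "a # as" bs] by auto
    then consider "{edge_midpoint a b, z} \<subseteq> insert (edge_midpoint a b) (bracket as (b # bs))"
      | "{edge_midpoint a b, z} \<subseteq> insert (edge_midpoint a b) (bracket (a # as) bs)"
      by blast
    then show ?thesis
      using 2(2) hull_mono by cases blast+
  qed
qed

text \<open>With an empty first list the inequality reads \<open>0 \<le> 1\<close>, so only a face
  of the standard simplex remains, and the coordinates of a point are its convex weights.\<close>

lemma bracket_Nil_left:
  fixes b :: "'n::finite list"
  assumes "distinct b"
  shows "bracket [] b = convex hull ((\<lambda>i. axis i 1) ` set b)"
proof
  show "convex hull ((\<lambda>i. axis i 1) ` set b) \<subseteq> bracket [] b"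
    using assms edge_midpoint_in_bracket[of "[]" b]
    by (intro hull_minimal convex_bracket) (auto simp flip: edge_midpoint_self)
  show "bracket [] b \<subseteq> convex hull ((\<lambda>i. axis i 1) ` set b)"
  proof
    fix y assume y: "y \<in> bracket [] b"
    then have "y = (\<Sum>i\<in>set b. (y $ i) *\<^sub>R axis i 1)"
      using assms by (auto simp: mem_bracket_iff vec_eq_iff axis_def if_distrib cong: if_cong)
    moreover have "(\<Sum>i\<in>set b. (y $ i) *\<^sub>R axis i 1) \<in> convex hull ((\<lambda>i. axis i 1) ` set b)"
      using y assms by (intro convex_sum) (auto simp: mem_bracket_iff hull_inc)
    ultimately show "y \<in> convex hull ((\<lambda>i. axis i 1) ` set b)" by (rule ssubst)
  qed
qed

text \<open>The sum over \<open>a\<close> would have to be both 1 and at most 0.\<close>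

lemma bracket_Nil_right:
  fixes a :: "'n::finite list"
  assumes "distinct a"
  shows "bracket a [] = {}"
  using assms by (auto simp: mem_bracket_iff)

text \<open>Provides the finite generating set that makes the bracket a polytope. Pairs with
  \<open>i = j\<close> contribute the vertices \<open>axis j 1\<close>.\<close>

lemma bracket_eq_convex_hull:
  fixes a b :: "'n::finite list"
  assumes "distinct (a @ b)"
  shows "bracket a b = convex hull ((\<lambda>(i, j). edge_midpoint i j) ` ((set a \<union> set b) \<times> set b))"
    (is "_ = convex hull (?V a b)")
proof
  show "convex hull (?V a b) \<subseteq> bracket a b"
    using assms edge_midpoint_in_bracket by (intro hull_minimal convex_bracket) auto
  show "bracket a b \<subseteq> convex hull (?V a b)"
    using assms
  proof (induction a arbitrary: b)
    case Nil
    have "(\<lambda>i. axis i 1) ` set b \<subseteq> ?V [] b"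
      by (force simp flip: edge_midpoint_self)
    then show ?case using Nil by (simp add: bracket_Nil_left hull_mono)
  next
    case (Cons x a)
    \<comment> \<open>Two nested inductions serve the two pieces of the decomposition: the outer
      hypothesis, valid for every second list, handles the shortened first list; the inner one
      handles the shortened second list.\<close>
    note outer_IH = Cons.IH
    from Cons.prems show ?case
    proof (induction b)
      case Nil
      then show ?case using bracket_Nil_right[of "x # a"] by simp
    next
      case (Cons y b)
      have M: "edge_midpoint x y \<in> convex hull ?V (x # a) (y # b)"
        by (rule hull_inc) auto
      have "bracket a (y # b) \<subseteq> convex hull ?V a (y # b)"
        using Cons.prems by (intro outer_IH) auto
      also have "\<dots> \<subseteq> convex hull ?V (x # a) (y # b)" by (rule hull_mono) auto
      finally have 1: "bracket a (y # b) \<subseteq> convex hull ?V (x # a) (y # b)" .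
      have "bracket (x # a) b \<subseteq> convex hull ?V (x # a) b"
        using Cons.prems by (intro Cons.IH) auto
      also have "\<dots> \<subseteq> convex hull ?V (x # a) (y # b)" by (rule hull_mono) auto
      finally have 2: "bracket (x # a) b \<subseteq> convex hull ?V (x # a) (y # b)" .
      have "convex hull (insert (edge_midpoint x y) (bracket a (y # b))) \<subseteq> convex hull ?V (x # a) (y # b)"
        "convex hull (insert (edge_midpoint x y) (bracket (x # a) b)) \<subseteq> convex hull ?V (x # a) (y # b)"
        using M 1 2 by (simp_all add: subset_hull)
      then show ?case using bracket_subset_Un[OF Cons.prems] by blast
    qed
  qed
qed

lemma polytope_bracket:
  fixes a b :: "'n::finite list"
  assumes "distinct (a @ b)"
  shows "polytope (bracket a b)"
  unfolding bracket_eq_convex_hull[OF assms] by (simp add: polytope_convex_hull)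

lemma polytope_convex_hull_insert:
  "polytope S \<Longrightarrow> polytope (convex hull (insert p S))"
  unfolding polytope_def by (metis finite_insert hull_insert)

text \<open>The dimension is \<open>int (card C) - 1\<close>, which is -1 for empty
  \<open>C\<close>.\<close>

lemma is_simplex_convex_hull:
  "\<not> affine_dependent C \<Longrightarrow> is_simplex (convex hull C)"
  unfolding is_simplex_def simplex_def
  by (metis aff_independent_finite diff_add_cancel of_nat_Suc)

lemma independent_axes: "independent ((\<lambda>i. axis i (1::real)) ` I :: (real ^ 'n::finite) set)"
  by (rule independent_mono[OF independent_Basis]) (auto simp: Basis_vec_def)

text \<open>Standard basis vectors are linearly, hence affinely, independent.\<close>

lemma is_simplex_bracket_Nil:
  fixes b :: "'n::finite list"
  assumes "distinct b"
  shows "is_simplex (bracket [] b)"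
  unfolding bracket_Nil_left[OF assms]
  using affine_dependent_imp_dependent independent_axes is_simplex_convex_hull by blast

theorem theorem2p1:
  fixes a b :: "'n::finite list"
  assumes "CARD('n) \<ge> 2"
    and "distinct (a @ b)"
    and "length b \<ge> 1"
    and "CARD('n) \<ge> length a + length b"
    and "length a + length b \<ge> 2"
    and "\<not> is_simplex (bracket a b)"
  shows "polytope (convex hull (insert (edge_midpoint (hd a) (hd b)) (bracket (tl a) b)))
    \<and> polytope (convex hull (insert (edge_midpoint (hd a) (hd b)) (bracket a (tl b))))
    \<and> bracket a b =
        convex hull (insert (edge_midpoint (hd a) (hd b)) (bracket (tl a) b)) \<union>
        convex hull (insert (edge_midpoint (hd a) (hd b)) (bracket a (tl b)))"
proof -
  note d = \<open>distinct (a @ b)\<close> and ns = \<open>\<not> is_simplex (bracket a b)\<close>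
  \<comment> \<open>Since the polytope is not a simplex, the first list is nonempty, so
    \<open>hd a\<close> and \<open>tl a\<close> have their intended meaning.\<close>
  from ns d is_simplex_bracket_Nil obtain x a' where a: "a = x # a'"
    by (cases a) auto
  from \<open>length b \<ge> 1\<close> obtain y b' where b: "b = y # b'"
    by (cases b) auto
  have M: "edge_midpoint x y \<in> bracket a b"
    using d by (intro edge_midpoint_in_bracket) (auto simp: a b)
  have "bracket a' b \<subseteq> bracket a b" "bracket a b' \<subseteq> bracket a b"
    using d bracket_Cons_left[of x a' b] bracket_Cons_right[of y a b'] by (auto simp: a b)
  \<comment> \<open>The easy inclusion: the convex set \<open>bracket a b\<close> contains the
    midpoint and both smaller polytopes.\<close>
  then have "convex hull (insert (edge_midpoint x y) (bracket a' b)) \<subseteq> bracket a b"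
    "convex hull (insert (edge_midpoint x y) (bracket a b')) \<subseteq> bracket a b"
    using M convex_bracket[OF d] by (simp_all add: subset_hull)
  moreover have "polytope (bracket a' b)" "polytope (bracket a b')"
    using d by (auto intro!: polytope_bracket simp: a b)
  ultimately show ?thesis
    using bracket_subset_Un[of x a' y b'] d
    by (simp add: a b polytope_convex_hull_insert subset_antisym)
qed

end
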